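(* Let $n$ be a positive integer, let $D=\{a_1,\ldots,a_m\}$ be a $B_2$-sequence over $\mathbb{Z}_n$, and let $n=\ell k$ with $\ell,k$ positive integers and $\gcd(\ell,k)=1$. Define the array $\mathcal{A}$ on $\mathbb{Z}^2$ by placing a dot at $(i,j)$ if and only if $a_t\equiv i\ell+jk\pmod n$ for some $t$. Then $\mathcal{A}$ is a doubly periodic $\ell\times k$ DDC of period $(k,\ell)$ and density $m/n$. Moreover, every $\ell\times k$ sub-array of $\mathcal{A}$ contains exactly $m$ dots.
   Context: For an abelian group $A$, a sequence $D=\{a_1,\ldots,a_m\}$ of $m$ distinct elements of $A$ is a $B_2$-sequence over $A$ if all sums $a_{i_1}+a_{i_2}$ with $1\le i_1\le i_2\le m$ are distinct. Points $(i,j)\in\mathbb{Z}^2$ are in column $i$ and row $j$. An array of dots $\mathcal{A}$ on $\mathbb{Z}^2$ is doubly periodic with period $(\eta,\kappa)$ if $(i,j)$ is a dot iff $(i+\eta,j)$ is a dot iff $(i,j+\kappa)$ is a dot, for all $i,j$; its density is $d/(\eta\kappa)$ where $d$ is the number of dots in any $\kappa\times\eta$ sub-array. An $a\times b$ sub-array is a set $\{(i_0+i,j_0+j):0\le i\le b-1,\ 0\le j\le a-1\}$ ($a$ rows, $b$ columns). A set of dots is a DDC if the vectors $x-y$, over ordered pairs $(x,y)$ of distinct dots, are pairwise distinct. A doubly periodic array is a doubly periodic $a\times b$ DDC if the dots in every $a\times b$ sub-array form a DDC. *)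

theory Defs
  imports Complex_Main
    "HOL-Algebra.Elementary_Groups"
    "HOL-Number_Theory.Cong"
    "HOL-Library.Product_Plus"
begin

(* The abelian group is written multiplicatively, as everywhere in HOL-Algebra;
   for integer_mod_group n the operation is addition modulo n. *)
definition B2_sequence :: "('a, 'b) monoid_scheme \<Rightarrow> nat \<Rightarrow> (nat \<Rightarrow> 'a) \<Rightarrow> bool" where
  "B2_sequence G m a \<longleftrightarrow>
     comm_group G \<and>
     (\<forall>t\<in>{1..m}. a t \<in> carrier G) \<and>
     inj_on a {1..m} \<and>
     inj_on (\<lambda>(s, t). a s \<otimes>\<^bsub>G\<^esub> a t) {(s, t). 1 \<le> s \<and> s \<le> t \<and> t \<le> m}"

(* An array is the set of its dots; (i, j) lies in column i and row j. *)
type_synonym dot_array = "(int \<times> int) set"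

(* The sub-array with r rows and c columns whose least column and row are i0 and j0. *)
definition subarray :: "nat \<Rightarrow> nat \<Rightarrow> int \<Rightarrow> int \<Rightarrow> (int \<times> int) set" where
  "subarray r c i0 j0 = {(i0 + i, j0 + j) | i j. 0 \<le> i \<and> i \<le> int c - 1 \<and> 0 \<le> j \<and> j \<le> int r - 1}"

definition doubly_periodic :: "dot_array \<Rightarrow> nat \<Rightarrow> nat \<Rightarrow> bool" where
  "doubly_periodic A \<eta> \<kappa> \<longleftrightarrow>
     (\<forall>i j. ((i, j) \<in> A \<longleftrightarrow> (i + int \<eta>, j) \<in> A) \<and> ((i, j) \<in> A \<longleftrightarrow> (i, j + int \<kappa>) \<in> A))"

definition DDC :: "(int \<times> int) set \<Rightarrow> bool" where
  "DDC S \<longleftrightarrow> inj_on (\<lambda>(x, y). x - y) {(x, y). x \<in> S \<and> y \<in> S \<and> x \<noteq> y}"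

definition doubly_periodic_DDC :: "dot_array \<Rightarrow> nat \<Rightarrow> nat \<Rightarrow> nat \<Rightarrow> nat \<Rightarrow> bool" where
  "doubly_periodic_DDC A r c \<eta> \<kappa> \<longleftrightarrow>
     doubly_periodic A \<eta> \<kappa> \<and> (\<forall>i0 j0. DDC (A \<inter> subarray r c i0 j0))"

(* A relation rather than a function of the array: it includes the claim that the
   number of dots does not depend on the chosen sub-array of one period. *)
definition has_density :: "dot_array \<Rightarrow> nat \<Rightarrow> nat \<Rightarrow> real \<Rightarrow> bool" where
  "has_density A \<eta> \<kappa> \<delta> \<longleftrightarrow>
     (\<exists>d. (\<forall>i0 j0. card (A \<inter> subarray \<kappa> \<eta> i0 j0) = d) \<and> \<delta> = real d / (real \<eta> * real \<kappa>))"

end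

theory Submission
  imports Defs
begin

text \<open>
  The map \<open>(i, j) \<mapsto> i l + j k\<close> is a homomorphism from \<open>\<int>\<^sup>2\<close> to \<open>\<int>\<^sub>n\<close> which, by the Chinese
  remainder theorem, is a bijection on every \<open>l \<times> k\<close> window. Hence every window contains one dot
  for each element of the sequence, and equal difference vectors \<open>x - y = x' - y'\<close> of dots in a
  window give equal sums of sequence elements belonging to \<open>x, y'\<close> and \<open>x', y\<close>.
\<close>

text \<open>The definition compares only sums over index pairs in nondecreasing order. Commutativity
  lets each pair be sorted by \<open>min\<close> and \<open>max\<close>, so equal sums force equal
  unordered pairs of elements.\<close>

lemma B2_sequence_sum_eqD:
  assumes "B2_sequence G m a"
    and "p \<in> a ` {1..m}" "q \<in> a ` {1..m}" "r \<in> a ` {1..m}" "s \<in> a ` {1..m}"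
    and "p \<otimes>\<^bsub>G\<^esub> q = r \<otimes>\<^bsub>G\<^esub> s"
  shows "p = r \<and> q = s \<or> p = s \<and> q = r"
proof -
  interpret comm_group G using assms(1) by (simp add: B2_sequence_def)
  obtain p' q' r' s' where idx: "p' \<in> {1..m}" "q' \<in> {1..m}" "r' \<in> {1..m}" "s' \<in> {1..m}"
    and eqs: "p = a p'" "q = a q'" "r = a r'" "s = a s'"
    using assms(2-5) by blast
  have carr: "a t \<in> carrier G" if "t \<in> {1..m}" for t
    using assms(1) that by (simp add: B2_sequence_def)
  have inj: "inj_on (\<lambda>(s, t). a s \<otimes>\<^bsub>G\<^esub> a t) {(s, t). 1 \<le> s \<and> s \<le> t \<and> t \<le> m}"
    using assms(1) by (simp add: B2_sequence_def)
  have sorted: "a u \<otimes>\<^bsub>G\<^esub> a v = a (min u v) \<otimes>\<^bsub>G\<^esub> a (max u v)"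
    if "u \<in> {1..m}" "v \<in> {1..m}" for u v
    using that carr by (auto simp: min_def max_def m_comm)
  have "(min p' q', max p' q') = (min r' s', max r' s')"
    by (rule inj_onD[OF inj]) (use idx assms(6) sorted eqs in auto)
  then have "p' = r' \<and> q' = s' \<or> p' = s' \<and> q' = r'"
    by (auto simp: min_def max_def split: if_splits)
  then show ?thesis using eqs by auto
qed

lemma DDC_I:
  assumes "\<And>x y x' y'. \<lbrakk>x \<in> S; y \<in> S; x' \<in> S; y' \<in> S; x \<noteq> y; x - y = x' - y'\<rbrakk>
    \<Longrightarrow> x = x' \<and> y = y'"
  shows "DDC S"
  unfolding DDC_def
proof (rule inj_onI)
  fix p q
  assume p: "p \<in> {(x, y). x \<in> S \<and> y \<in> S \<and> x \<noteq> y}"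
    and q: "q \<in> {(x, y). x \<in> S \<and> y \<in> S \<and> x \<noteq> y}"
    and eq: "(case p of (x, y) \<Rightarrow> x - y) = (case q of (x, y) \<Rightarrow> x - y)"
  have "fst p = fst q \<and> snd p = snd q"
    by (rule assms) (use p q eq in \<open>simp_all add: case_prod_beta\<close>)
  then show "p = q" by (rule prod_eq_iff[THEN iffD2])
qed

lemma image_vimage_Int: "f ` (f -` B \<inter> S) = B \<inter> f ` S"
  by blast

text \<open>In this form the cardinality of a window and the separation of its two coordinates are
  immediate.\<close>

lemma subarray_eq_Times: "subarray r c i0 j0 = {i0..<i0 + int c} \<times> {j0..<j0 + int r}"
proof -
  have "(x, y) \<in> subarray r c i0 j0" if "x \<in> {i0..<i0 + int c}" "y \<in> {j0..<j0 + int r}" for x y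
    using that unfolding subarray_def mem_Collect_eq
    by (intro exI[of _ "x - i0"] exI[of _ "y - j0"]) auto
  then show ?thesis by (auto simp: subarray_def)
qed

text \<open>A multiple of \<open>c\<close> of absolute value below \<open>c\<close> must be
  0.\<close>

lemma cong_window_imp_eq:
  fixes x y c :: int
  assumes "[x = y] (mod c)" "x \<in> {z..<z + c}" "y \<in> {z..<z + c}"
  shows "x = y"
proof -
  have "c dvd x - y" using assms(1) by (simp add: cong_iff_dvd_diff)
  moreover have "\<bar>x - y\<bar> < c" using assms(2,3) by auto
  ultimately show ?thesis using zdvd_imp_le[of c "\<bar>x - y\<bar>"] by (cases "x = y") auto
qed

text \<open>Modulo \<open>k\<close> only \<open>i * int l\<close> survives, and \<open>l\<close> is
  a unit there, so the value fixes the column modulo \<open>k\<close>; symmetrically it fixes the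
  row modulo \<open>l\<close>. A window has exactly \<open>k\<close> columns and \<open>l\<close>
  rows, hence injectivity.\<close>

lemma fold_map_bij_betw:
  fixes l k :: nat
  assumes "l > 0" "k > 0" "coprime l k"
  shows "bij_betw (\<lambda>(i, j). (i * int l + j * int k) mod int (l * k))
           (subarray l k i0 j0) {0..<int (l * k)}"
    (is "bij_betw ?f ?S ?N")
proof -
  have cop: "coprime (int l) (int k)" "coprime (int k) (int l)"
    using assms(3) by (simp_all add: coprime_commute)
  have inj: "inj_on ?f ?S"
  proof (intro inj_onI, clarify)
    fix i j i' j'
    assume S: "(i, j) \<in> ?S" "(i', j') \<in> ?S"
      and "(i * int l + j * int k) mod int (l * k) = (i' * int l + j' * int k) mod int (l * k)"
    then have c: "[i * int l + j * int k = i' * int l + j' * int k] (mod int l * int k)"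
      by (simp add: cong_def)
    have "[i * int l + j * int k = i' * int l + j' * int k] (mod int k)"
      using c by (rule cong_dvd_modulus) simp
    then have "[i * int l = i' * int l] (mod int k)"
      by (simp add: cong_def)
    then have "[i = i'] (mod int k)"
      using cop(1) by (simp add: cong_mult_rcancel)
    moreover have "[i * int l + j * int k = i' * int l + j' * int k] (mod int l)"
      using c by (rule cong_dvd_modulus) simp
    then have "[j * int k = j' * int k] (mod int l)"
      by (simp add: cong_def)
    then have "[j = j'] (mod int l)"
      using cop(2) by (simp add: cong_mult_rcancel)
    ultimately show "i = i' \<and> j = j'"
      using S cong_window_imp_eq unfolding subarray_eq_Times by blast
  qed
  \<comment> \<open>Surjectivity comes by counting: the window has as many cells as there are
    residues.\<close>
  have "?f ` ?S \<subseteq> ?N" using assms(1,2) by auto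
  moreover have "card (?f ` ?S) = card ?N"
    unfolding card_image[OF inj] by (simp add: subarray_eq_Times nat_mult_distrib)
  ultimately have "?f ` ?S = ?N" by (intro card_subset_eq) auto
  with inj show ?thesis by (simp add: bij_betw_def)
qed

theorem theorem15:
  fixes n m l k :: nat and a :: "nat \<Rightarrow> int" and A :: dot_array
  assumes "n > 0"
    and "B2_sequence (integer_mod_group n) m a"
    and "n = l * k" and "l > 0" and "k > 0" and "gcd l k = 1"
    and "A = {(i, j). \<exists>t\<in>{1..m}. [a t = i * int l + j * int k] (mod int n)}"
  shows "doubly_periodic_DDC A l k k l
    \<and> has_density A k l (real m / real n)
    \<and> (\<forall>i0 j0. card (A \<inter> subarray l k i0 j0) = m)"
proof -
  define f where "f = (\<lambda>(i, j). (i * int l + j * int k) mod int n)"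
  \<comment> \<open>For positive \<open>n\<close> the carrier consists of the least nonnegative
    residues, so each \<open>a t\<close> equals its own remainder and congruence to it becomes an
    equation on \<open>f\<close>.\<close>
  have a_range: "a ` {1..m} \<subseteq> {0..<int n}" and a_inj: "inj_on a {1..m}"
    using assms(1,2) by (auto simp: B2_sequence_def carrier_integer_mod_group)
  have A_eq: "A = f -` (a ` {1..m})"
  proof -
    have "[a t = x] (mod int n) \<longleftrightarrow> x mod int n = a t" if "t \<in> {1..m}" for t x
      using a_range that by (auto simp: cong_def image_subset_iff)
    then have "(i, j) \<in> A \<longleftrightarrow> (i, j) \<in> f -` (a ` {1..m})" for i j
      unfolding assms(7) f_def image_iff vimage_def by simp
    then show ?thesis by (simp add: set_eq_iff split_paired_all)
  qed
  have bij: "bij_betw f (subarray l k i0 j0) {0..<int n}" for i0 j0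
    using fold_map_bij_betw[of l k] assms(3-6) by (simp add: f_def coprime_iff_gcd_eq_1)
  have card: "card (A \<inter> subarray l k i0 j0) = m" for i0 j0
  proof -
    \<comment> \<open>The dots are a full preimage under \<open>f\<close>, so the bijection on the
      window restricts to one from its dots onto the values of the sequence.\<close>
    have "bij_betw f (A \<inter> subarray l k i0 j0) (a ` {1..m})"
    proof (rule bij_betw_subset[OF bij])
      have "f ` (A \<inter> subarray l k i0 j0) = a ` {1..m} \<inter> f ` subarray l k i0 j0"
        unfolding A_eq by (rule image_vimage_Int)
      also have "\<dots> = a ` {1..m}"
        unfolding bij_betw_imp_surj_on[OF bij] using a_range by (rule Int_absorb2)
      finally show "f ` (A \<inter> subarray l k i0 j0) = a ` {1..m}" .
    qed (rule Int_lower2)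
    then show ?thesis
      using card_image[OF a_inj] by (simp add: bij_betw_same_card)
  qed
  have "f (i + int k, j) = f (i, j)" "f (i, j + int l) = f (i, j)" for i j
  proof -
    \<comment> \<open>A shift by \<open>k\<close> columns or by \<open>l\<close> rows adds
      \<open>l * k\<close>, which is 0 modulo \<open>n\<close>.\<close>
    have "(i + int k) * int l + j * int k = i * int l + j * int k + int n"
      "i * int l + (j + int l) * int k = i * int l + j * int k + int n"
      unfolding assms(3) by (simp_all add: algebra_simps)
    then show "f (i + int k, j) = f (i, j)" "f (i, j + int l) = f (i, j)"
      by (simp_all only: f_def prod.case mod_add_self2)
  qed
  then have "doubly_periodic A k l"
    by (simp add: doubly_periodic_def A_eq)
  moreover have "DDC (A \<inter> subarray l k i0 j0)" for i0 j0
  proof (rule DDC_I)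
    fix x y x' y'
    let ?S = "subarray l k i0 j0"
    assume mem: "x \<in> A \<inter> ?S" "y \<in> A \<inter> ?S" "x' \<in> A \<inter> ?S" "y' \<in> A \<inter> ?S"
      and ne: "x \<noteq> y" and diff: "x - y = x' - y'"
    have inj: "inj_on f ?S" using bij by (simp add: bij_betw_def)
    have f_add: "f (u + v) = f u \<otimes>\<^bsub>integer_mod_group n\<^esub> f v" for u v
      by (cases u; cases v) (simp add: f_def mod_simps, simp add: algebra_simps)
    have "x + y' = x' + y" using diff by (simp add: algebra_simps)
    then have "f x \<otimes>\<^bsub>integer_mod_group n\<^esub> f y' = f x' \<otimes>\<^bsub>integer_mod_group n\<^esub> f y"
      by (metis f_add)
    then have "f x = f x' \<and> f y' = f y \<or> f x = f y \<and> f y' = f x'"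
      using mem by (intro B2_sequence_sum_eqD[OF assms(2)]) (simp_all only: A_eq Int_iff vimage_eq)
    \<comment> \<open>The second alternative contains \<open>f x = f y\<close>, which injectivity on
      the window excludes since \<open>x\<close> and \<open>y\<close> differ; the first gives the
      claim by the same injectivity.\<close>
    then show "x = x' \<and> y = y'"
      using mem ne by (metis IntD2 inj inj_onD)
  qed
  \<comment> \<open>A period block is itself a window of \<open>l\<close> rows and \<open>k\<close>
    columns, so it holds \<open>m\<close> dots among \<open>n\<close> cells.\<close>
  moreover have "has_density A k l (real m / real n)"
    unfolding has_density_def using card assms(3) by (auto simp: mult.commute)
  ultimately show ?thesis
    using card by (simp add: doubly_periodic_DDC_def)
qed

end
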